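(* For every integer $n\ge 1$, the set of labeled interval orders on $[n]$ is in bijection with the disjoint union $$\bigsqcup_{S\subseteq [n-1]} \boldsymbol{\beta}_n(S)\times\boldsymbol{\kappa}_n(S),$$ which may alternatively be written as the set $$\{(\pi,\tau)\in\mathcal{S}_n\times\mathcal{S}_n : A(\tau)\subseteq D(\pi)\}.$$
   Context: $[n]=\{1,\dots,n\}$ and $\mathcal{S}_n$ is the set of permutations of $[n]$, written as words $\pi=a_1a_2\cdots a_n$. The set of descent positions of $\pi$ is $D(\pi)=\{i\in[n-1] : a_i>a_{i+1}\}$. The set of ascent bottoms of $\pi$ is the set of values $A(\pi)=\{a_i : i\in[n-1],\ a_i<a_{i+1}\}$. For $S\subseteq[n-1]$, $\boldsymbol{\beta}_n(S)=\{\pi\in\mathcal{S}_n : D(\pi)=S\}$ and $\boldsymbol{\kappa}_n(S)=\{\pi\in\mathcal{S}_n : A(\pi)\subseteq S\}$. A poset $P$ is an interval order if each $z\in P$ can be assigned a closed real interval $[l_z,r_z]$ such that $x<_P y$ if and only if $r_x<l_y$. A labeled interval order on $[n]$ is a partial order on the set $[n]$ that is an interval order (two such are the same only if they are equal as relations on $[n]$). *)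

theory Defs
  imports Complex_Main "HOL-Combinatorics.Permutations"
begin

text \<open>The word \<open>a\<^sub>1 a\<^sub>2 \<dots> a\<^sub>n\<close> of a permutation \<open>p permutes {1..n}\<close> has the letters \<open>a\<^sub>i = p i\<close>.\<close>

definition descent_positions :: "nat \<Rightarrow> (nat \<Rightarrow> nat) \<Rightarrow> nat set" where
  "descent_positions n p = {i \<in> {1..n - 1}. p i > p (i + 1)}"

definition ascent_bottoms :: "nat \<Rightarrow> (nat \<Rightarrow> nat) \<Rightarrow> nat set" where
  "ascent_bottoms n p = {p i | i. i \<in> {1..n - 1} \<and> p i < p (i + 1)}"

definition beta :: "nat \<Rightarrow> nat set \<Rightarrow> (nat \<Rightarrow> nat) set" where
  "beta n S = {p. p permutes {1..n} \<and> descent_positions n p = S}"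

definition kappa :: "nat \<Rightarrow> nat set \<Rightarrow> (nat \<Rightarrow> nat) set" where
  "kappa n S = {p. p permutes {1..n} \<and> ascent_bottoms n p \<subseteq> S}"

text \<open>Orders are reflexive relations, so the strict order is membership together with \<open>x \<noteq> y\<close>.
  The closed intervals are required to be nonempty, but may be single points.\<close>

definition interval_order_on :: "'a set \<Rightarrow> 'a rel \<Rightarrow> bool" where
  "interval_order_on A r \<longleftrightarrow> partial_order_on A r \<and>
     (\<exists>lo hi :: 'a \<Rightarrow> real. (\<forall>z\<in>A. lo z \<le> hi z) \<and>
       (\<forall>x\<in>A. \<forall>y\<in>A. (x, y) \<in> r \<and> x \<noteq> y \<longleftrightarrow> hi x < lo y))"

definition labeled_interval_orders :: "nat \<Rightarrow> nat rel set" where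
  "labeled_interval_orders n = {r. interval_order_on {1..n} r}"

end

theory Submission
  imports Defs
begin

text \<open>
  Sort the elements of an interval order by decreasing up-set, equal up-sets by label; this gives a
  word \<open>p\<close>. As the up-sets form a chain, every down-set is an initial segment of \<open>p\<close>, so the order is
  determined by \<open>p\<close> together with the sizes \<open>f j < j\<close> of the strict down-sets of the letters \<open>p j\<close>. The
  up-set shrinks from position \<open>i\<close> to position \<open>i + 1\<close> exactly if \<open>i\<close> is a value of \<open>f\<close>, so interval
  orders correspond to pairs \<open>(p, f)\<close> with \<open>f j < j\<close> and every descent position of \<open>p\<close> a value of \<open>f\<close>.

  Inserting \<open>1, \<dots>, n\<close> successively, each \<open>v\<close> right after the letter \<open>f v\<close>, turns \<open>f\<close> into a word starting
  with \<open>0\<close> whose ascent bottoms are the values of \<open>f\<close>. Read cyclically, every letter of this word is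
  either an ascent bottom or a descent top, so \<open>x \<mapsto> n - x\<close> followed by a rotation that brings \<open>0\<close> to the
  front complements the set of ascent bottoms. Reversing \<open>p\<close> complements its set of descent positions
  in the same way, and the inclusion of sets is turned around.
\<close>

section \<open>Words and their ascent bottoms\<close>

text \<open>List form of \<open>ascent_bottoms\<close>, which can be split and rotated.\<close>

fun asc_list :: "'a::linorder list \<Rightarrow> 'a set" where
  "asc_list (x # y # xs) = (if x < y then {x} else {}) \<union> asc_list (y # xs)"
| "asc_list xs = {}"

lemma asc_list_Cons:
  "asc_list (x # xs) = (if xs \<noteq> [] \<and> x < hd xs then {x} else {}) \<union> asc_list xs"
  by (cases xs) auto

text \<open>The letter \<open>y\<close> is shared by both pieces, so that no adjacent pair is
  lost.\<close>

lemma asc_list_append_Cons: "asc_list (xs @ y # ys) = asc_list (xs @ [y]) \<union> asc_list (y # ys)"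
  by (induction xs rule: asc_list.induct) auto

lemma asc_list_subset: "asc_list xs \<subseteq> set (butlast xs)"
  by (induction xs rule: asc_list.induct) auto

lemma set_butlast: "xs \<noteq> [] \<Longrightarrow> distinct xs \<Longrightarrow> set (butlast xs) = set xs - {last xs}"
  by (cases xs rule: rev_cases) auto

lemma asc_list_snoc_max:
  assumes "xs \<noteq> []" "\<forall>x\<in>set xs. x < m"
  shows "asc_list (xs @ [m]) = insert (last xs) (asc_list xs)"
  using assms by (induction xs rule: asc_list.induct) auto

lemma asc_list_snoc_0: "asc_list (xs @ [0 :: nat]) = asc_list xs"
  by (induction xs rule: asc_list.induct) auto

lemma asc_list_Cons_max:
  assumes "\<forall>x\<in>set xs. x < m"
  shows "asc_list (m # xs) = asc_list xs"
  using assms by (cases xs) auto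

lemma asc_list_map_upt:
  "asc_list (map t [0..<Suc n]) = {t i | i. i < n \<and> t i < t (Suc i)}"
proof (induction n)
  case (Suc n)
  have "asc_list (map t [0..<Suc (Suc n)]) = asc_list (map t [0..<n] @ t n # [t (Suc n)])"
    by simp
  also have "\<dots> = asc_list (map t [0..<Suc n]) \<union> asc_list [t n, t (Suc n)]"
    by (subst asc_list_append_Cons) simp
  finally show ?case unfolding Suc.IH by (auto simp: less_Suc_eq)
qed simp

text \<open>Complementing exchanges ascents and descents, and every letter but the last starts
  exactly one of the two. As no letter occurs twice, a set difference suffices. The bound
  \<open>n\<close> keeps truncated subtraction strictly decreasing.\<close>

lemma asc_list_complement:
  fixes xs :: "nat list"
  assumes "distinct xs" "set xs \<subseteq> {0..n}"
  shows "asc_list (map (\<lambda>x. n - x) xs) = (\<lambda>x. n - x) ` (set (butlast xs) - asc_list xs)"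
  using assms
proof (induction xs rule: asc_list.induct)
  case (1 x y xs)
  have "x \<notin> asc_list (y # xs)" "x \<notin> set (butlast (y # xs))"
    using "1.prems"(1) asc_list_subset[of "y # xs"] in_set_butlastD[of x "y # xs"] by auto
  moreover have "n - x < n - y \<longleftrightarrow> \<not> x < y"
    using "1.prems" by auto
  ultimately show ?case using 1 by auto
qed auto

text \<open>A permutation of \<open>{1..n}\<close> is written as a word on \<open>{0..n}\<close> with a leading \<open>0\<close>, because the
  complement \<open>x \<mapsto> n - x\<close> below acts on these words read cyclically.\<close>

definition zero_words :: "nat \<Rightarrow> nat list set" where
  "zero_words n = {w. distinct w \<and> set w = {0..n} \<and> hd w = 0}"

lemma zero_words_length: "w \<in> zero_words n \<Longrightarrow> length w = Suc n"
  by (auto simp: zero_words_def dest: distinct_card)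

text \<open>A permutation of \<open>{1..n}\<close> fixes \<open>0\<close>, so listing from index
  \<open>0\<close> supplies the leading letter.\<close>

lemma bij_betw_zero_words:
  "bij_betw (\<lambda>t. map t [0..<Suc n]) {t. t permutes {1..n}} (zero_words n)"
proof (rule bij_betw_imageI)
  show "inj_on (\<lambda>t. map t [0..<Suc n]) {t. t permutes {1..n}}"
  proof (rule inj_onI)
    fix s t assume s: "s \<in> {t. t permutes {1..n}}" and t: "t \<in> {t. t permutes {1..n}}"
      and eq: "map s [0..<Suc n] = map t [0..<Suc n]"
    have "s i = t i" for i
    proof (cases "i \<in> {1..n}")
      case True
      then show ?thesis using eq by (auto simp del: upt_Suc)
    next
      case False
      then show ?thesis using s t by (simp add: permutes_not_in)
    qed
    then show "s = t" by auto
  qed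
  show "(\<lambda>t. map t [0..<Suc n]) ` {t. t permutes {1..n}} = zero_words n"
  proof (intro equalityI subsetI)
    fix w assume "w \<in> (\<lambda>t. map t [0..<Suc n]) ` {t. t permutes {1..n}}"
    then obtain t where t: "t permutes {1..n}" and w: "w = map t [0..<Suc n]" by blast
    have "t permutes {0..n}" using t by (rule permutes_subset) auto
    then have "t ` {0..n} = {0..n}" "inj t" by (rule permutes_image, rule permutes_inj)
    moreover have "t 0 = 0" using t by (simp add: permutes_not_in)
    moreover have "set w = t ` {0..n}"
      unfolding w by (simp only: set_map set_upt atLeastLessThanSuc_atLeastAtMost)
    moreover have "distinct w"
      unfolding w distinct_map using inj_on_subset[OF \<open>inj t\<close> subset_UNIV] distinct_upt by blast
    moreover have "hd w = t 0" unfolding w by (subst upt_conv_Cons) simp_all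
    ultimately show "w \<in> zero_words n" by (simp add: zero_words_def)
  next
    fix w assume w: "w \<in> zero_words n"
    define t where "t = (\<lambda>i. if i \<in> {0..n} then w ! i else i)"
    have len: "length w = Suc n" using w by (rule zero_words_length)
    have "bij_betw (\<lambda>i. w ! i) {0..n} {0..n}"
      using w by (intro bij_betw_nth)
        (simp_all add: zero_words_def len lessThan_Suc_atMost atLeast0AtMost)
    then have "bij_betw t {0..n} {0..n}"
      by (rule bij_betw_cong[THEN iffD1, rotated]) (simp add: t_def)
    then have "t permutes {0..n}"
      by (rule bij_imp_permutes) (simp add: t_def)
    moreover have "t 0 = 0"
      using w len by (cases w) (auto simp: t_def zero_words_def)
    ultimately have "t permutes {1..n}"
      by (auto intro!: permutes_superset[where S = "{0..n}"] simp: Suc_le_eq)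
    moreover have "map t [0..<Suc n] = w"
      using len by (intro nth_equalityI) (auto simp: t_def simp del: upt_Suc)
    ultimately show "w \<in> (\<lambda>t. map t [0..<Suc n]) ` {t. t permutes {1..n}}" by blast
  qed
qed

text \<open>The leading \<open>0\<close> can only add the value \<open>0\<close>, which no later
  position takes.\<close>

lemma ascent_bottoms_eq:
  assumes "t permutes {1..n}"
  shows "ascent_bottoms n t = asc_list (map t [0..<Suc n]) - {0}"
proof -
  have "t 0 = 0" using assms by (simp add: permutes_not_in)
  then have "t i = 0 \<longleftrightarrow> i = 0" for i
    using permutes_inj[OF assms] by (metis injD)
  then have "i \<in> {1..n - 1} \<longleftrightarrow> i < n \<and> t i \<noteq> 0" for i
    by (simp only: atLeastAtMost_iff) linarith
  then have "ascent_bottoms n t = {t i | i. (i < n \<and> t i \<noteq> 0) \<and> t i < t (Suc i)}"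
    unfolding ascent_bottoms_def by (simp only: Suc_eq_plus1)
  also have "\<dots> = {t i | i. i < n \<and> t i < t (Suc i)} - {0}" by auto
  finally show ?thesis unfolding asc_list_map_upt .
qed

section \<open>Subdiagonal functions and words\<close>

fun insert_after :: "'a \<Rightarrow> 'a \<Rightarrow> 'a list \<Rightarrow> 'a list" where
  "insert_after a m [] = []"
| "insert_after a m (x # xs) = (if x = a then x # m # xs else x # insert_after a m xs)"

lemma insert_after_Nil_iff [simp]: "insert_after a m xs = [] \<longleftrightarrow> xs = []"
  by (cases xs) auto

lemma hd_insert_after: "hd (insert_after a m xs) = hd xs"
  by (cases xs) auto

lemma set_insert_after: "a \<in> set xs \<Longrightarrow> set (insert_after a m xs) = insert m (set xs)"
  by (induction xs) auto

lemma distinct_insert_after: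
  "distinct xs \<Longrightarrow> m \<notin> set xs \<Longrightarrow> distinct (insert_after a m xs)"
proof (induction xs)
  case (Cons x xs)
  have "set (insert_after a m xs) \<subseteq> insert m (set xs)" by (induction xs) auto
  with Cons show ?case by auto
qed simp

lemma remove1_insert_after:
  "a \<in> set xs \<Longrightarrow> m \<notin> set xs \<Longrightarrow> remove1 m (insert_after a m xs) = xs"
  by (induction xs) auto

text \<open>The parameter can be recovered as the left neighbour of \<open>m\<close>.\<close>

lemma insert_after_eq_imp_eq:
  "\<lbrakk>insert_after a m xs = insert_after b m xs; a \<in> set xs; b \<in> set xs; m \<notin> set xs\<rbrakk> \<Longrightarrow> a = b"
proof (induction xs)
  case (Cons x xs)
  \<comment> \<open>\<open>m\<close> never comes first in the rest, so if only one of
    \<open>a\<close>, \<open>b\<close> were the head \<open>x\<close>, the second letters would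
    differ.\<close>
  have hd: "hd (insert_after c m xs) \<noteq> m" if "c \<in> set xs" for c
    using that Cons.prems by (cases xs) auto
  from Cons hd[of a] hd[of b] show ?case
    by (auto split: if_splits) (metis list.sel(1))+
qed simp

text \<open>The maximum \<open>m\<close> makes \<open>a\<close> an ascent bottom, or keeps it one,
  and is not one itself. No other old letter gets a new successor.\<close>

lemma asc_list_insert_after:
  assumes "a \<in> set xs" "distinct xs" "\<forall>x\<in>set xs. x < m"
  shows "asc_list (insert_after a m xs) = insert a (asc_list xs)"
  using assms
proof (induction xs)
  case (Cons x xs)
  show ?case
  proof (cases "x = a")
    case True
    have "asc_list (a # m # xs) = insert a (asc_list xs)"
      using Cons.prems True by (simp add: asc_list_Cons_max)
    then show ?thesis using True asc_list_Cons[of a xs] by auto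
  next
    case False
    then have "asc_list (insert_after a m xs) = insert a (asc_list xs)" "xs \<noteq> []"
      using Cons by auto
    then show ?thesis using False by (auto simp: asc_list_Cons[of x] hd_insert_after)
  qed
qed simp

text \<open>A subdiagonal \<open>f\<close> is the parent function of an increasing tree on
  \<open>{0..n}\<close> with root \<open>0\<close>; the word is its preorder, with children in
  decreasing order.\<close>

primrec tree_word :: "nat \<Rightarrow> (nat \<Rightarrow> nat) \<Rightarrow> nat list" where
  "tree_word 0 f = [0]"
| "tree_word (Suc n) f = insert_after (f (Suc n)) (Suc n) (tree_word n f)"

text \<open>Inversion sequences. By extensionality they are determined by their values on
  \<open>{1..n}\<close>, so there are \<open>fact n\<close> of them.\<close>

abbreviation subdiagonal :: "nat \<Rightarrow> (nat \<Rightarrow> nat) set" where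
  "subdiagonal n \<equiv> (\<Pi>\<^sub>E v\<in>{1..n}. {..<v})"

lemma subdiagonal_less: "f \<in> subdiagonal n \<Longrightarrow> 1 \<le> v \<Longrightarrow> v \<le> n \<Longrightarrow> f v < v"
  by (fastforce dest: PiE_mem)

text \<open>The bound is stated pointwise because extensionality would not pass from
  \<open>Suc n\<close> to \<open>n\<close> in the induction.\<close>

lemma tree_word_zero_words:
  assumes "\<forall>v\<in>{1..n}. f v < v"
  shows "tree_word n f \<in> zero_words n \<and> asc_list (tree_word n f) = f ` {1..n}"
  using assms
proof (induction n)
  case (Suc n)
  then have IH: "tree_word n f \<in> zero_words n" "asc_list (tree_word n f) = f ` {1..n}" by auto
  then have w: "distinct (tree_word n f)" "set (tree_word n f) = {0..n}" "hd (tree_word n f) = 0"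
    by (auto simp: zero_words_def)
  moreover have "f (Suc n) < Suc n" using Suc.prems by simp
  then have "f (Suc n) \<in> set (tree_word n f)" using w by simp
  ultimately have "tree_word (Suc n) f \<in> zero_words (Suc n)"
    by (auto simp: zero_words_def distinct_insert_after set_insert_after hd_insert_after)
  moreover have "asc_list (tree_word (Suc n) f) = insert (f (Suc n)) (f ` {1..n})"
    using w \<open>f (Suc n) \<in> set (tree_word n f)\<close> IH(2) by (simp add: asc_list_insert_after)
  ultimately show ?case by (simp add: atLeastAtMostSuc_conv)
qed (simp add: zero_words_def)

text \<open>Deleting the largest letter undoes the last insertion, and its left neighbour was the
  last value of \<open>f\<close>.\<close>

lemma tree_word_inj:
  assumes "\<forall>v\<in>{1..n}. f v < v" "\<forall>v\<in>{1..n}. g v < v" "tree_word n f = tree_word n g"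
  shows "\<forall>v\<in>{1..n}. f v = g v"
  using assms
proof (induction n)
  case (Suc n)
  have f: "set (tree_word n f) = {0..n}" and g: "set (tree_word n g) = {0..n}"
    using Suc.prems tree_word_zero_words[of n f] tree_word_zero_words[of n g]
    by (auto simp: zero_words_def)
  have "f (Suc n) < Suc n" "g (Suc n) < Suc n" using Suc.prems(1,2) by simp_all
  then have lt: "f (Suc n) \<in> {0..n}" "g (Suc n) \<in> {0..n}" by simp_all
  have eq: "tree_word n f = tree_word n g"
    using Suc.prems(3) f g lt
      remove1_insert_after[of "f (Suc n)" "tree_word n f" "Suc n"]
      remove1_insert_after[of "g (Suc n)" "tree_word n g" "Suc n"] by simp
  then have "f (Suc n) = g (Suc n)"
    using Suc.prems(3) f g lt insert_after_eq_imp_eq[of "f (Suc n)" "Suc n" "tree_word n f" "g (Suc n)"]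
    by simp
  with eq Suc show ?case by (auto simp: atLeastAtMostSuc_conv)
qed simp

lemma card_zero_words: "card (zero_words n) = fact n"
  using bij_betw_same_card[OF bij_betw_zero_words[of n]] card_permutations[of "{1..n}" n] by simp

text \<open>Surjectivity comes from counting: both sides have \<open>fact n\<close>
  elements.\<close>

lemma bij_betw_tree_word: "bij_betw (tree_word n) (subdiagonal n) (zero_words n)"
proof -
  have inj: "inj_on (tree_word n) (subdiagonal n)"
  proof (rule inj_onI)
    fix f g assume fg: "f \<in> subdiagonal n" "g \<in> subdiagonal n" "tree_word n f = tree_word n g"
    then have "\<forall>v\<in>{1..n}. f v = g v"
      by (intro tree_word_inj) (auto intro: subdiagonal_less)
    with fg show "f = g" by (intro PiE_ext[of f _ _ g]) auto
  qed
  have "tree_word n ` subdiagonal n \<subseteq> zero_words n"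
    using tree_word_zero_words subdiagonal_less by fastforce
  moreover have "card (subdiagonal n) = fact n"
    by (simp add: card_PiE fact_prod)
  moreover have "finite (zero_words n)"
    using bij_betw_finite[OF bij_betw_zero_words[of n]] by (simp add: finite_permutations)
  ultimately have "tree_word n ` subdiagonal n = zero_words n"
    using inj by (intro card_subset_eq) (auto simp: card_image card_zero_words)
  with inj show ?thesis by (rule bij_betw_imageI)
qed

section \<open>Complementing the set of ascent bottoms\<close>

text \<open>The rotation is done before the complement, hence it brings \<open>n\<close>, not
  \<open>0\<close>, to the front.\<close>

definition rotate_complement :: "nat \<Rightarrow> nat list \<Rightarrow> nat list" where
  "rotate_complement n w = map (\<lambda>x. n - x) (dropWhile (\<lambda>x. x \<noteq> n) w @ takeWhile (\<lambda>x. x \<noteq> n) w)"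

lemma rotate_complement_split:
  assumes "n \<notin> set xs"
  shows "rotate_complement n (xs @ n # ys) = map (\<lambda>x. n - x) (n # ys @ xs)"
proof -
  have "takeWhile (\<lambda>x. x \<noteq> n) (xs @ n # ys) = xs" "dropWhile (\<lambda>x. x \<noteq> n) (xs @ n # ys) = n # ys"
    using assms by (subst takeWhile_append2 dropWhile_append2; auto)+
  then show ?thesis by (simp add: rotate_complement_def)
qed

lemma zero_words_split:
  assumes "w \<in> zero_words n" "n \<ge> 1"
  obtains xs ys where "w = 0 # xs @ n # ys" "distinct (xs @ ys)" "set (xs @ ys) = {1..<n}"
proof -
  from assms obtain w' where w: "w = 0 # w'" "distinct w" "set w = {0..n}"
    by (cases w) (auto simp: zero_words_def)
  then have "distinct w'" "set w' = set w - {0}" by auto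
  then have w': "distinct w'" "set w' = {1..n}" using w(3) by auto
  with assms(2) obtain xs ys where s: "w' = xs @ n # ys"
    by (metis atLeastAtMost_iff order_refl split_list)
  have "set (xs @ ys) = set w' - {n}" using w'(1) s by auto
  also have "\<dots> = {1..<n}" unfolding w'(2) by auto
  finally show ?thesis using that w(1) w'(1) s by auto
qed

text \<open>A zero word is closed to a cycle by a step down to \<open>0\<close>, so reading it
  cyclically changes no ascent bottoms. The bound on \<open>n\<close> excludes the one-letter cycle,
  whose letter starts neither an ascent nor a descent.\<close>

lemma rotate_complement_zero_words:
  assumes "w \<in> zero_words n" "n \<ge> 1"
  shows "rotate_complement n w \<in> zero_words n" (is ?words)
    and "rotate_complement n (rotate_complement n w) = w" (is ?inv)
    and "asc_list (rotate_complement n w) = (\<lambda>x. n - x) ` ({0..n} - asc_list w)" (is ?asc)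
proof -
  let ?c = "\<lambda>x. n - x"
  obtain xs ys where w: "w = 0 # xs @ n # ys" and d: "distinct (xs @ ys)"
    and s: "set (xs @ ys) = {1..<n}" using zero_words_split assms by blast
  have le: "set xs \<subseteq> {1..<n}" "set ys \<subseteq> {1..<n}" using s by auto
  then have "n \<notin> set (0 # xs)" using assms(2) by auto
  then have rc: "rotate_complement n w = 0 # map ?c ys @ n # map ?c xs"
    using rotate_complement_split[of n "0 # xs" ys] w by simp
  have inj: "inj_on ?c {0..n}" by (auto simp: inj_on_def)
  have img: "?c ` {1..<n} = {1..<n}"
  proof (intro equalityI subsetI)
    fix x assume "x \<in> {1..<n}"
    then show "x \<in> ?c ` {1..<n}" by (intro image_eqI[of _ _ "n - x"]) auto
  qed auto
  have "distinct (map ?c (ys @ xs))"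
  proof -
    have "set (ys @ xs) \<subseteq> {0..n}" using le by auto
    then have "inj_on ?c (set (ys @ xs))" by (rule inj_on_subset[OF inj])
    moreover have "distinct (ys @ xs)" using d by auto
    ultimately show ?thesis by (simp only: distinct_map)
  qed
  moreover have s': "set (map ?c (ys @ xs)) = {1..<n}"
  proof -
    have "set (map ?c (ys @ xs)) = ?c ` set (xs @ ys)" by auto
    then show ?thesis unfolding s img .
  qed
  ultimately have "distinct (0 # map ?c ys @ n # map ?c xs)"
    using assms(2) by auto
  moreover have "set (0 # map ?c ys @ n # map ?c xs) = insert 0 (insert n {1..<n})"
    using s' by auto
  moreover have "insert 0 (insert n {1..<n}) = {0..n}" using assms(2) by auto
  ultimately show ?words by (simp add: rc zero_words_def)
  have "n \<notin> set (0 # map ?c ys)" using le(2) assms(2) by fastforce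
  then have "rotate_complement n (0 # map ?c ys @ n # map ?c xs)
      = map ?c (n # map ?c xs @ 0 # map ?c ys)"
    using rotate_complement_split[of n "0 # map ?c ys" "map ?c xs"] by simp
  moreover have "map (?c \<circ> ?c) zs = zs" if "set zs \<subseteq> {1..<n}" for zs
    using that by (intro map_idI) auto
  note this[OF le(1)] this[OF le(2)]
  ultimately show ?inv unfolding rc by (simp add: w)
  have dw: "distinct w" "set w = {0..n}" using assms by (auto simp: zero_words_def)
  \<comment> \<open>The image is cut at its letter \<open>n\<close>, which comes from the
    \<open>0\<close> of \<open>w\<close>. The pieces are the arc of \<open>w\<close> from
    \<open>n\<close> round to that \<open>0\<close>, and the arc from \<open>0\<close> up to but
    excluding \<open>n\<close>.\<close>
  have "asc_list (rotate_complement n w)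
      = asc_list (map ?c (n # ys @ [0])) \<union> asc_list (map ?c (0 # xs))"
    unfolding rc using asc_list_append_Cons[of "0 # map ?c ys" n "map ?c xs"] by simp
  \<comment> \<open>The closing \<open>0\<close> makes the last letter of \<open>n # ys\<close> a
    descent top, so this letter is counted too.\<close>
  also have "asc_list (map ?c (n # ys @ [0])) = ?c ` (set (n # ys) - asc_list (n # ys))"
  proof -
    have "asc_list (n # ys @ [0]) = asc_list (n # ys)" using asc_list_snoc_0[of "n # ys"] by simp
    then show ?thesis using dw w by (subst asc_list_complement) (auto simp: butlast_append)
  qed
  \<comment> \<open>The last letter of \<open>0 # xs\<close> is followed by \<open>n\<close> in
    \<open>w\<close>; as an ascent bottom there it is removed, in accordance with
    \<open>butlast\<close>.\<close>
  also have "asc_list (map ?c (0 # xs)) = ?c ` (set (0 # xs) - asc_list (0 # xs @ [n]))"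
  proof -
    have "asc_list (0 # xs @ [n]) = insert (last (0 # xs)) (asc_list (0 # xs))"
      using asc_list_snoc_max[of "0 # xs" n] le(1) assms(2) by force
    moreover have "set (butlast (0 # xs)) = set (0 # xs) - {last (0 # xs)}"
      using dw(1) w by (intro set_butlast) auto
    moreover have "asc_list (map ?c (0 # xs)) = ?c ` (set (butlast (0 # xs)) - asc_list (0 # xs))"
      using dw w by (intro asc_list_complement) auto
    ultimately show ?thesis by (simp only: Diff_insert2[symmetric])
  qed
  also have "?c ` (set (n # ys) - asc_list (n # ys)) \<union> ?c ` (set (0 # xs) - asc_list (0 # xs @ [n]))
      = ?c ` ({0..n} - asc_list w)"
  proof -
    have "asc_list w = asc_list (0 # xs @ [n]) \<union> asc_list (n # ys)"
      unfolding w using asc_list_append_Cons[of "0 # xs" n ys] by simp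
    moreover have "asc_list (0 # xs @ [n]) \<subseteq> set (0 # xs)"
      using asc_list_subset[of "0 # xs @ [n]"] by (simp add: butlast_append)
    moreover have "asc_list (n # ys) \<subseteq> set (n # ys)"
      using asc_list_subset[of "n # ys"] by (blast dest: in_set_butlastD)
    moreover have "{0..n} = set (n # ys) \<union> set (0 # xs)"
      unfolding dw(2)[symmetric] w by auto
    moreover have "set (n # ys) \<inter> set (0 # xs) = {}" using dw(1) w by auto
    ultimately have "{0..n} - asc_list w
        = (set (n # ys) - asc_list (n # ys)) \<union> (set (0 # xs) - asc_list (0 # xs @ [n]))" by blast
    then show ?thesis by (simp add: image_Un)
  qed
  finally show ?asc .
qed

lemma bij_betw_rotate_complement:
  "n \<ge> 1 \<Longrightarrow> bij_betw (rotate_complement n) (zero_words n) (zero_words n)"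
  by (rule bij_betw_byWitness[where f' = "rotate_complement n"])
    (auto simp: rotate_complement_zero_words)

lemma bij_betw_subdiagonal_permutations:
  assumes "n \<ge> 1"
  obtains g where "bij_betw g (subdiagonal n) {t. t permutes {1..n}}"
    "\<And>f. f \<in> subdiagonal n \<Longrightarrow> ascent_bottoms n (g f) = (\<lambda>x. n - x) ` ({1..n - 1} - f ` {1..n})"
proof -
  let ?W = "\<lambda>t. map t [0..<Suc n]" and ?P = "{t. t permutes {1..n}}"
  let ?h = "inv_into ?P ?W"
  define g where "g = ?h \<circ> (rotate_complement n \<circ> tree_word n)"
  have wbij: "bij_betw (rotate_complement n \<circ> tree_word n) (subdiagonal n) (zero_words n)"
    using bij_betw_tree_word bij_betw_rotate_complement[OF assms] by (rule bij_betw_trans)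
  then have g: "bij_betw g (subdiagonal n) ?P"
    unfolding g_def using bij_betw_inv_into[OF bij_betw_zero_words[of n]] by (rule bij_betw_trans)
  moreover have "ascent_bottoms n (g f) = (\<lambda>x. n - x) ` ({1..n - 1} - f ` {1..n})"
    if f: "f \<in> subdiagonal n" for f
  proof -
    have fv: "\<forall>v\<in>{1..n}. f v < v" using f by (auto intro: subdiagonal_less)
    have "g f permutes {1..n}" using bij_betwE[OF g] f by blast
    then have "ascent_bottoms n (g f) = asc_list (?W (g f)) - {0}" by (rule ascent_bottoms_eq)
    also have "?W (g f) = rotate_complement n (tree_word n f)"
      unfolding g_def comp_def
      using bij_betw_inv_into_right[OF bij_betw_zero_words[of n]] bij_betwE[OF wbij] f by simp
    also have "asc_list \<dots> = (\<lambda>x. n - x) ` ({0..n} - f ` {1..n})"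
      using tree_word_zero_words[OF fv] assms by (simp add: rotate_complement_zero_words)
    \<comment> \<open>The value \<open>f 1 = 0\<close> excludes \<open>0\<close>, and the letter
      \<open>n\<close> is sent to \<open>0\<close> and dropped. A complement within
      \<open>{1..n - 1}\<close> remains.\<close>
    also have "\<dots> - {0} = (\<lambda>x. n - x) ` ({1..n - 1} - f ` {1..n})"
    proof -
      have "f 1 = 0" using fv assms by auto
      then have "0 \<in> f ` {1..n}" using assms by (metis atLeastAtMost_iff image_eqI order_refl)
      moreover have "{0..n} = insert 0 (insert n {1..n - 1})" using assms by auto
      ultimately have "{0..n} - f ` {1..n} = ({1..n - 1} - f ` {1..n}) \<union> ({n} - f ` {1..n})"
        by (simp only: insert_Diff_if) auto
      then show ?thesis by auto
    qed
    finally show ?thesis .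
  qed
  ultimately show ?thesis using that by blast
qed

section \<open>Interval orders\<close>

text \<open>The letters of \<open>p\<close> below \<open>p j\<close> are \<open>p 1, \<dots>, p (f j)\<close>.\<close>

definition order_of :: "nat \<Rightarrow> (nat \<Rightarrow> nat) \<times> (nat \<Rightarrow> nat) \<Rightarrow> nat rel" where
  "order_of n = (\<lambda>(p, f). {(p i, p j) | i j. i \<in> {1..n} \<and> j \<in> {1..n} \<and> (i = j \<or> i \<le> f j)})"

text \<open>Encodes the lexicographic order by decreasing up-set, then by label, in a single number.\<close>

definition order_key :: "nat \<Rightarrow> nat rel \<Rightarrow> nat \<Rightarrow> nat" where
  "order_key n r x = (n - card (aboveS r x)) * Suc n + x"

text \<open>An order may arise from several pairs; the inclusion selects the one where elements with
  equal up-sets are sorted by label.\<close>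

definition order_codes :: "nat \<Rightarrow> ((nat \<Rightarrow> nat) \<times> (nat \<Rightarrow> nat)) set" where
  "order_codes n = {(p, f). p permutes {1..n} \<and> f \<in> subdiagonal n \<and> descent_positions n p \<subseteq> f ` {1..n}}"

section \<open>Sorting by the key\<close>

lemma mult_Suc_add_less_iff:
  fixes a b n x y :: nat
  assumes "x \<le> n" "y \<le> n"
  shows "a * Suc n + x < b * Suc n + y \<longleftrightarrow> a < b \<or> a = b \<and> x < y"
proof -
  have *: "c * Suc n + u < d * Suc n + v" if "c < d" "u \<le> n" for c d u v
  proof -
    have "c * Suc n + u < Suc c * Suc n" using that by simp
    also have "\<dots> \<le> d * Suc n" using that by (intro mult_le_mono1) simp
    finally show ?thesis by simp
  qed
  show ?thesis using *[of a b x y] *[of b a y x] assms by (cases a b rule: linorder_cases) auto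
qed

text \<open>Keys are two-digit numbers in base \<open>Suc n\<close>: labels and sizes of up-sets are
  at most \<open>n\<close>, so neither a carry nor the truncated subtraction interferes.\<close>

lemma order_key_less_iff:
  assumes "r \<subseteq> {1..n} \<times> {1..n}" "x \<in> {1..n}" "y \<in> {1..n}"
  shows "order_key n r x < order_key n r y \<longleftrightarrow>
    card (aboveS r y) < card (aboveS r x) \<or> card (aboveS r x) = card (aboveS r y) \<and> x < y"
proof -
  have "card (aboveS r z) \<le> n" for z
    using card_mono[of "{1..n}" "aboveS r z"] assms(1) by (auto simp: aboveS_def)
  from this[of x] this[of y] show ?thesis
    unfolding order_key_def using assms(2,3) by (subst mult_Suc_add_less_iff) auto
qed

lemma inj_on_order_key:
  assumes "r \<subseteq> {1..n} \<times> {1..n}"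
  shows "inj_on (order_key n r) {1..n}"
  by (rule linorder_inj_onI') (use order_key_less_iff[OF assms] in \<open>metis linorder_neq_iff\<close>)

text \<open>Existence comes from \<open>sort_key\<close>; uniqueness holds because a strictly
  increasing list is determined by its set, here the image of \<open>{1..n}\<close> under
  \<open>k\<close>.\<close>

lemma sorting_permutation:
  fixes k :: "nat \<Rightarrow> 'a::linorder"
  assumes "inj_on k {1..n}"
  shows "\<exists>!p. p permutes {1..n} \<and> strict_mono_on {1..n} (k \<circ> p)"
proof (rule ex_ex1I)
  define w where "w = sort_key k [1..<Suc n]"
  define p where "p i = (if i \<in> {1..n} then w ! (i - 1) else i)" for i
  have w: "distinct w" "set w = {1..n}" "length w = n" by (auto simp: w_def)
  have "bij_betw (\<lambda>i. i - 1) {1..n} {..<n}"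
    by (rule bij_betw_byWitness[where f' = Suc]) auto
  moreover have "bij_betw (\<lambda>i. w ! i) {..<n} {1..n}" using w by (intro bij_betw_nth) auto
  ultimately have "bij_betw ((\<lambda>i. w ! i) \<circ> (\<lambda>i. i - 1)) {1..n} {1..n}" by (rule bij_betw_trans)
  then have "bij_betw p {1..n} {1..n}"
    by (rule bij_betw_cong[THEN iffD1, rotated]) (simp add: p_def)
  then have perm: "p permutes {1..n}" by (rule bij_imp_permutes) (auto simp: p_def)
  have "sorted (map k w)" by (simp add: w_def)
  moreover have "distinct (map k w)" using w assms by (simp add: distinct_map)
  ultimately have "sorted_wrt (<) (map k w)" by (simp add: strict_sorted_iff)
  then have "strict_mono_on {1..n} (k \<circ> p)"
    using w by (auto simp: strict_mono_on_def p_def sorted_wrt_iff_nth_less)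
  with perm show "\<exists>p. p permutes {1..n} \<and> strict_mono_on {1..n} (k \<circ> p)" by blast
next
  fix p q assume p: "p permutes {1..n} \<and> strict_mono_on {1..n} (k \<circ> p)"
    and q: "q permutes {1..n} \<and> strict_mono_on {1..n} (k \<circ> q)"
  have "sorted_wrt (<) (map (k \<circ> u) [1..<Suc n])" "set (map (k \<circ> u) [1..<Suc n]) = k ` {1..n}"
    if "u permutes {1..n} \<and> strict_mono_on {1..n} (k \<circ> u)" for u
  proof -
    show "sorted_wrt (<) (map (k \<circ> u) [1..<Suc n])"
      using that by (auto simp: sorted_wrt_iff_nth_less strict_mono_on_def simp del: upt_Suc)
    have "set (map (k \<circ> u) [1..<Suc n]) = k ` u ` {1..n}"
      by (simp add: image_comp atLeastLessThanSuc_atLeastAtMost del: upt_Suc)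
    then show "set (map (k \<circ> u) [1..<Suc n]) = k ` {1..n}" using that by (simp add: permutes_image)
  qed
  from strict_sorted_equal[OF this(1)[OF p] this(1)[OF q]] this(2)[OF p] this(2)[OF q]
  have "map (k \<circ> p) [1..<Suc n] = map (k \<circ> q) [1..<Suc n]" by simp
  then have eq: "k (p i) = k (q i)" if "i \<in> {1..n}" for i
    using that by (auto simp del: upt_Suc)
  have "p i = q i" for i
  proof (cases "i \<in> {1..n}")
    case True
    then show ?thesis using eq[OF True] assms p q by (meson inj_onD permutes_in_image)
  next
    case False
    then show ?thesis using p q by (metis permutes_not_in)
  qed
  then show "p = q" by auto
qed

section \<open>The interval order of a pair\<close>

lemma order_of_iff:
  assumes "p permutes {1..n}" "i \<in> {1..n}" "j \<in> {1..n}"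
  shows "(p i, p j) \<in> order_of n (p, f) \<longleftrightarrow> i = j \<or> i \<le> f j"
  using assms permutes_inj[OF assms(1)] by (auto simp: order_of_def dest: injD)

lemma order_of_subset: "p permutes {1..n} \<Longrightarrow> order_of n (p, f) \<subseteq> {1..n} \<times> {1..n}"
  using permutes_in_image[of p "{1..n}"] unfolding order_of_def by blast

lemma permutes_surjE:
  assumes "p permutes A" "x \<in> A"
  obtains i where "i \<in> A" "x = p i"
  using assms permutes_image by blast

lemma order_of_interval_order:
  assumes p: "p permutes {1..n}" and f: "f \<in> subdiagonal n"
  shows "order_of n (p, f) \<in> labeled_interval_orders n"
proof -
  let ?r = "order_of n (p, f)" and ?i = "inv p"
  have inv: "?i (p i) = i" for i using p by (simp add: permutes_inverses)
  have lt: "i \<le> f j \<Longrightarrow> j \<in> {1..n} \<Longrightarrow> i < j" for i j using subdiagonal_less[OF f, of j] by simp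
  have "refl_on {1..n} ?r"
  proof (rule refl_onI)
    fix x assume "x \<in> {1..n}"
    with p obtain i where "i \<in> {1..n}" "x = p i" by (rule permutes_surjE)
    then show "(x, x) \<in> ?r" by (simp add: order_of_iff[OF p])
  qed
  moreover have "trans ?r"
  proof (rule transI)
    fix x y z assume xy: "(x, y) \<in> ?r" and yz: "(y, z) \<in> ?r"
    then have "x \<in> {1..n}" "y \<in> {1..n}" "z \<in> {1..n}" using order_of_subset[OF p] by blast+
    then obtain i j k where ijk: "i \<in> {1..n}" "j \<in> {1..n}" "k \<in> {1..n}" "x = p i" "y = p j" "z = p k"
      using permutes_surjE[OF p] by metis
    then have "i = j \<or> i \<le> f j" "j = k \<or> j \<le> f k" using xy yz by (simp_all add: order_of_iff[OF p])
    then have "i = k \<or> i \<le> f k" using lt[of i j] ijk by auto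
    then show "(x, z) \<in> ?r" using ijk by (simp add: order_of_iff[OF p])
  qed
  moreover have "antisym ?r"
  proof (rule antisymI)
    fix x y assume xy: "(x, y) \<in> ?r" and yx: "(y, x) \<in> ?r"
    then have "x \<in> {1..n}" "y \<in> {1..n}" using order_of_subset[OF p] by blast+
    then obtain i j where ij: "i \<in> {1..n}" "j \<in> {1..n}" "x = p i" "y = p j"
      using permutes_surjE[OF p] by metis
    then have "i = j \<or> i \<le> f j" "j = i \<or> j \<le> f i" using xy yx by (simp_all add: order_of_iff[OF p])
    then show "x = y" using lt[of i j] lt[of j i] ij by auto
  qed
  moreover have "\<exists>lo hi :: nat \<Rightarrow> real. (\<forall>z\<in>{1..n}. lo z \<le> hi z) \<and>
       (\<forall>x\<in>{1..n}. \<forall>y\<in>{1..n}. (x, y) \<in> ?r \<and> x \<noteq> y \<longleftrightarrow> hi x < lo y)"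
  proof (intro exI conjI ballI)
    fix z assume "z \<in> {1..n}"
    with p obtain i where "i \<in> {1..n}" "z = p i" by (rule permutes_surjE)
    \<comment> \<open>The letter at position \<open>i\<close> gets the interval from
      \<open>f i\<close> to \<open>i - 1 / 2\<close>. The half turns the strict comparison of
      endpoints into \<open>i \<le> f j\<close>, and \<open>f i < i\<close> keeps the interval
      nonempty.\<close>
    then show "real (f (?i z)) \<le> real (?i z) - 1 / 2" using lt[of "f i" i] by (simp add: inv)
  next
    fix x y assume "x \<in> {1..n}" "y \<in> {1..n}"
    then obtain i j where ij: "i \<in> {1..n}" "j \<in> {1..n}" "x = p i" "y = p j"
      using permutes_surjE[OF p] by metis
    then have "(x, y) \<in> ?r \<and> x \<noteq> y \<longleftrightarrow> i \<le> f j"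
      using lt[of i j] permutes_inj[OF p] by (auto simp: order_of_iff[OF p] dest: injD)
    then show "(x, y) \<in> ?r \<and> x \<noteq> y \<longleftrightarrow> real (?i x) - 1 / 2 < real (f (?i y))"
      using ij by (simp add: inv) linarith
  qed
  ultimately show ?thesis
    using order_of_subset[OF p]
    by (simp add: labeled_interval_orders_def interval_order_on_def partial_order_on_def preorder_on_def)
qed

lemma order_of_underS:
  assumes p: "p permutes {1..n}" and f: "f \<in> subdiagonal n" and j: "j \<in> {1..n}"
  shows "underS (order_of n (p, f)) (p j) = p ` {1..f j}"
proof (intro equalityI subsetI)
  fix x assume x: "x \<in> underS (order_of n (p, f)) (p j)"
  then have "x \<in> {1..n}" using order_of_subset[OF p, of f] by (auto simp: underS_def)
  with p obtain i where i: "i \<in> {1..n}" "x = p i" by (rule permutes_surjE)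
  with x j show "x \<in> p ` {1..f j}" by (auto simp: underS_def order_of_iff[OF p])
next
  fix x assume "x \<in> p ` {1..f j}"
  then obtain i where i: "1 \<le> i" "i \<le> f j" "x = p i" by auto
  moreover have "f j < j" using subdiagonal_less[OF f, of j] j by simp
  ultimately show "x \<in> underS (order_of n (p, f)) (p j)"
    using order_of_iff[OF p, of i j f] inj_eq[OF permutes_inj[OF p], of i j] assms(3)
    unfolding underS_def by auto
qed

lemma order_of_aboveS:
  assumes p: "p permutes {1..n}" and f: "f \<in> subdiagonal n" and i: "i \<in> {1..n}"
  shows "aboveS (order_of n (p, f)) (p i) = p ` {j \<in> {1..n}. i \<le> f j}"
proof (intro equalityI subsetI)
  fix x assume x: "x \<in> aboveS (order_of n (p, f)) (p i)"
  then have "x \<in> {1..n}" using order_of_subset[OF p, of f] by (auto simp: aboveS_def)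
  with p obtain j where j: "j \<in> {1..n}" "x = p j" by (rule permutes_surjE)
  with x i show "x \<in> p ` {j \<in> {1..n}. i \<le> f j}" by (auto simp: aboveS_def order_of_iff[OF p])
next
  fix x assume "x \<in> p ` {j \<in> {1..n}. i \<le> f j}"
  then obtain j where j: "j \<in> {1..n}" "i \<le> f j" "x = p j" by auto
  moreover have "f j < j" using subdiagonal_less[OF f, of j] j by simp
  ultimately show "x \<in> aboveS (order_of n (p, f)) (p i)"
    using order_of_iff[OF p, of i j f] inj_eq[OF permutes_inj[OF p], of i j] assms(3)
    unfolding aboveS_def by auto
qed

text \<open>From position \<open>i\<close> to \<open>Suc i\<close> the up-set loses exactly the
  letters \<open>p j\<close> with \<open>f j = i\<close>. If there are any, its size drops;
  otherwise \<open>i\<close> is not a descent and the label grows. Hence \<open>p\<close> is the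
  sorting permutation for the key of its order.\<close>

lemma strict_mono_on_order_key:
  assumes p: "p permutes {1..n}" and f: "f \<in> subdiagonal n"
    and D: "descent_positions n p \<subseteq> f ` {1..n}"
  shows "strict_mono_on {1..n} (order_key n (order_of n (p, f)) \<circ> p)"
proof -
  let ?k = "order_key n (order_of n (p, f)) \<circ> p"
  have step: "?k i < ?k (Suc i)" if i: "1 \<le> i" "Suc i \<le> n" for i
  proof -
    let ?U = "\<lambda>i. {j \<in> {1..n}. i \<le> f j}"
    have U: "card (aboveS (order_of n (p, f)) (p i)) = card (?U i)" if "i \<in> {1..n}" for i
      using order_of_aboveS[OF p f that] permutes_inj[OF p] by (simp add: card_image inj_on_subset)
    have mem: "p i \<in> {1..n}" "p (Suc i) \<in> {1..n}" using i unfolding permutes_in_image[OF p] by simp_all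
    show ?thesis
    proof (cases "i \<in> f ` {1..n}")
      case True
      then obtain j where "j \<in> {1..n}" "f j = i" by blast
      then have "j \<in> ?U i" "j \<notin> ?U (Suc i)" by auto
      moreover have "?U (Suc i) \<subseteq> ?U i" by auto
      ultimately have "?U (Suc i) \<subset> ?U i" by blast
      then have "card (?U (Suc i)) < card (?U i)" by (intro psubset_card_mono) auto
      then show ?thesis using i mem U by (simp add: order_key_less_iff[OF order_of_subset[OF p]])
    next
      case False
      then have "?U (Suc i) = ?U i"
        by (intro Collect_cong) (metis Suc_leD Suc_leI imageI le_neq_implies_less)
      moreover have "p i < p (Suc i)"
      proof -
        have "i \<notin> descent_positions n p" using D False by blast
        moreover have "i \<in> {1..n - 1}" using i by auto
        ultimately have "p i \<le> p (Suc i)" by (simp add: descent_positions_def)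
        moreover have "p i \<noteq> p (Suc i)" by (simp add: inj_eq[OF permutes_inj[OF p]])
        ultimately show ?thesis by simp
      qed
      ultimately show ?thesis using i mem U by (simp add: order_key_less_iff[OF order_of_subset[OF p]])
    qed
  qed
  have "?k i < ?k j" if "1 \<le> i" "i < j" "j \<le> n" for i j
    using that(2,3)
  proof (induction j)
    case (Suc j)
    then show ?case using step[of j] step[of i] that(1) by (cases "i = j") (auto intro: less_trans)
  qed simp
  then show ?thesis by (auto simp: strict_mono_on_def)
qed

text \<open>The order determines its key and thereby the sorting permutation \<open>p\<close>; then
  \<open>f j\<close> is the size of the strict down-set of \<open>p j\<close>.\<close>

lemma inj_on_order_of: "inj_on (order_of n) (order_codes n)"
proof (rule inj_onI, clarify)
  fix p f q g
  assume "(p, f) \<in> order_codes n" "(q, g) \<in> order_codes n" and eq: "order_of n (p, f) = order_of n (q, g)"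
  then have p: "p permutes {1..n}" "f \<in> subdiagonal n" "descent_positions n p \<subseteq> f ` {1..n}"
    and q: "q permutes {1..n}" "g \<in> subdiagonal n" "descent_positions n q \<subseteq> g ` {1..n}"
    by (auto simp: order_codes_def)
  have pq: "p = q"
    using sorting_permutation[OF inj_on_order_key[OF order_of_subset[OF p(1), of f]]]
      strict_mono_on_order_key[OF p] strict_mono_on_order_key[OF q] p(1) q(1) eq by metis
  have "f j = g j" if "j \<in> {1..n}" for j
  proof -
    have "p ` {1..f j} = p ` {1..g j}"
      using order_of_underS[OF p(1,2) that] order_of_underS[OF q(1,2) that] eq pq by simp
    then have "card {1..f j} = card {1..g j}"
      using permutes_inj[OF p(1)] by (metis card_image inj_on_subset subset_UNIV)
    then show ?thesis by simp
  qed
  then have "f = g" using p(2) q(2) by (intro PiE_ext[of f _ _ g]) auto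
  with pq show "p = q \<and> f = g" by simp
qed

text \<open>The up-set of \<open>x\<close> consists of the elements whose left endpoint exceeds
  \<open>hi x\<close>, so comparing right endpoints compares up-sets.\<close>

lemma interval_order_aboveS_chain:
  assumes r: "r \<in> labeled_interval_orders n" and "x \<in> {1..n}" "y \<in> {1..n}"
  shows "aboveS r x \<subseteq> aboveS r y \<or> aboveS r y \<subseteq> aboveS r x"
proof -
  from r obtain lo hi :: "nat \<Rightarrow> real" where sub: "r \<subseteq> {1..n} \<times> {1..n}"
    and lohi: "\<And>x y. x \<in> {1..n} \<Longrightarrow> y \<in> {1..n} \<Longrightarrow> (x, y) \<in> r \<and> x \<noteq> y \<longleftrightarrow> hi x < lo y"
    unfolding labeled_interval_orders_def interval_order_on_def partial_order_on_def preorder_on_def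
    by blast
  have "aboveS r x = {z \<in> {1..n}. hi x < lo z}" if "x \<in> {1..n}" for x
    using sub lohi[OF that] unfolding aboveS_def by blast
  with assms show ?thesis by auto
qed

lemma order_of_surj:
  assumes r: "r \<in> labeled_interval_orders n"
  shows "r \<in> order_of n ` order_codes n"
proof -
  have sub: "r \<subseteq> {1..n} \<times> {1..n}" and refl: "\<And>x. x \<in> {1..n} \<Longrightarrow> (x, x) \<in> r"
    using r by (auto simp: labeled_interval_orders_def interval_order_on_def partial_order_on_def
        preorder_on_def refl_on_def)
  obtain p where p: "p permutes {1..n}" and mono: "strict_mono_on {1..n} (order_key n r \<circ> p)"
    using sorting_permutation[OF inj_on_order_key[OF sub]] by blast
  have pin: "p i \<in> {1..n} \<longleftrightarrow> i \<in> {1..n}" for i by (rule permutes_in_image[OF p])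
  have fin: "finite (aboveS r x)" for x
  proof (rule finite_subset)
    show "aboveS r x \<subseteq> {1..n}" using sub by (auto simp: aboveS_def)
  qed simp
  have key: "order_key n r (p i) < order_key n r (p j) \<longleftrightarrow>
      card (aboveS r (p j)) < card (aboveS r (p i)) \<or>
      card (aboveS r (p i)) = card (aboveS r (p j)) \<and> p i < p j"
    if "i \<in> {1..n}" "j \<in> {1..n}" for i j
    by (rule order_key_less_iff[OF sub]) (simp_all only: pin that)
  \<comment> \<open>Since up-sets form a chain, comparing their sizes decides inclusion.\<close>
  have up: "aboveS r (p j) \<subseteq> aboveS r (p i)" if "i \<in> {1..n}" "j \<in> {1..n}" "i \<le> j" for i j
  proof (cases "i = j")
    case False
    with that mono have "order_key n r (p i) < order_key n r (p j)" by (auto simp: strict_mono_on_def)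
    then have "card (aboveS r (p j)) \<le> card (aboveS r (p i))"
      using key[OF that(1,2)] by auto
    moreover have "aboveS r (p i) \<subseteq> aboveS r (p j) \<or> aboveS r (p j) \<subseteq> aboveS r (p i)"
      by (rule interval_order_aboveS_chain[OF r]) (simp_all only: pin that)
    ultimately show ?thesis using card_seteq[OF fin, of "aboveS r (p i)" "p j"] by blast
  qed simp
  let ?D = "\<lambda>j. {i \<in> {1..n}. p i \<in> underS r (p j)}"
  define f where "f = (\<lambda>j\<in>{1..n}. card (?D j))"
  have D: "?D j = {1..f j}" if j: "j \<in> {1..n}" for j
  proof -
    \<comment> \<open>An earlier letter has an up-set containing that of \<open>p i\<close>, so it
      lies below \<open>p j\<close> as well.\<close>
    have down: "i' \<in> ?D j" if "i \<in> ?D j" "1 \<le> i'" "i' \<le> i" for i i'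
    proof -
      have "i' \<in> {1..n}" "i \<in> {1..n}" "p j \<in> aboveS r (p i)"
        using that by (auto simp: underS_def aboveS_def)
      with up[of i' i] that(3) show ?thesis by (auto simp: underS_def aboveS_def)
    qed
    have "?D j \<subseteq> {1..f j}"
    proof
      fix i assume i: "i \<in> ?D j"
      then have "{1..i} \<subseteq> ?D j" using down[OF i] by auto
      then have "card {1..i} \<le> card (?D j)" by (intro card_mono) auto
      with i j show "i \<in> {1..f j}" by (simp add: f_def)
    qed
    then show ?thesis using j by (intro card_subset_eq) (auto simp: f_def)
  qed
  have rel: "(p i, p j) \<in> r \<and> p i \<noteq> p j \<longleftrightarrow> i \<le> f j" if "i \<in> {1..n}" "j \<in> {1..n}" for i j
  proof -
    have "(p i, p j) \<in> r \<and> p i \<noteq> p j \<longleftrightarrow> i \<in> ?D j" using that by (auto simp: underS_def)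
    then show ?thesis unfolding D[OF that(2)] using that by simp
  qed
  have "f \<in> subdiagonal n"
  proof (rule PiE_I)
    fix j assume j: "j \<in> {1..n}"
    \<comment> \<open>\<open>j \<le> f j\<close> would put \<open>p j\<close> strictly below
      itself.\<close>
    then show "f j \<in> {..<j}" using rel[of j j] by auto
  qed (auto simp: f_def)
  moreover have "descent_positions n p \<subseteq> f ` {1..n}"
  proof
    fix i assume "i \<in> descent_positions n p"
    then have i: "i \<in> {1..n}" "Suc i \<in> {1..n}" "p i > p (Suc i)" by (auto simp: descent_positions_def)
    with mono have "order_key n r (p i) < order_key n r (p (Suc i))" by (simp add: strict_mono_on_def)
    \<comment> \<open>The label falls at a descent, so the key can only grow because the up-set
      shrinks. A letter lost from the up-set then has exactly \<open>i\<close> letters below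
      it.\<close>
    then have "card (aboveS r (p (Suc i))) < card (aboveS r (p i))"
      using key[OF i(1,2)] i(3) by auto
    then have "\<not> aboveS r (p i) \<subseteq> aboveS r (p (Suc i))"
      using card_mono[OF fin] by (metis not_le)
    then obtain y where y: "y \<in> aboveS r (p i)" "y \<notin> aboveS r (p (Suc i))" by blast
    then have "y \<in> {1..n}" using sub by (auto simp: aboveS_def)
    with p obtain j where j: "j \<in> {1..n}" "y = p j" by (rule permutes_surjE)
    then have "i \<le> f j" "\<not> Suc i \<le> f j"
      using y rel[OF i(1) j(1)] rel[OF i(2) j(1)] by (auto simp: aboveS_def)
    then show "i \<in> f ` {1..n}" using j by (intro image_eqI[of _ _ j]) auto
  qed
  ultimately have "(p, f) \<in> order_codes n" using p by (simp add: order_codes_def)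
  moreover have "r = order_of n (p, f)"
  proof -
    have "(x, y) \<in> r \<longleftrightarrow> (x, y) \<in> order_of n (p, f)" if "x \<in> {1..n}" "y \<in> {1..n}" for x y
    proof -
      from that obtain i j where ij: "i \<in> {1..n}" "j \<in> {1..n}" "x = p i" "y = p j"
        using permutes_surjE[OF p] by metis
      then show ?thesis
        using rel[OF ij(1,2)] refl[OF that(1)] order_of_iff[OF p ij(1,2), of f]
          inj_eq[OF permutes_inj[OF p], of i j] by auto
    qed
    then show ?thesis using sub order_of_subset[OF p, of f] by auto
  qed
  ultimately show ?thesis by blast
qed

lemma bij_betw_order_of: "bij_betw (order_of n) (order_codes n) (labeled_interval_orders n)"
  using inj_on_order_of order_of_surj order_of_interval_order
  by (intro bij_betw_imageI) (auto simp: order_codes_def)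

section \<open>Reversing a permutation\<close>

definition reflect :: "nat \<Rightarrow> nat \<Rightarrow> nat" where
  "reflect n i = (if i \<in> {1..n} then Suc n - i else i)"

lemma bij_betw_reflect:
  "bij_betw (\<lambda>p. p \<circ> reflect n) {p. p permutes {1..n}} {p. p permutes {1..n}}"
proof -
  have "reflect n permutes {1..n}"
    by (rule bij_imp_permutes, rule bij_betw_byWitness[where f' = "reflect n"]) (auto simp: reflect_def)
  moreover have "reflect n \<circ> reflect n = id" by (rule ext) (auto simp: reflect_def)
  ultimately show ?thesis
    by (intro bij_betw_byWitness[where f' = "\<lambda>p. p \<circ> reflect n"])
      (auto simp: comp_assoc permutes_compose)
qed

text \<open>The pair at \<open>i\<close>, \<open>i + 1\<close> of the reversed word is the pair at
  \<open>n - i\<close>, \<open>n - i + 1\<close> read backwards; as letters are distinct, exactly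
  one of the two is a descent.\<close>

lemma descent_positions_reflect:
  assumes p: "p permutes {1..n}"
  shows "descent_positions n (p \<circ> reflect n) = {i \<in> {1..n - 1}. n - i \<notin> descent_positions n p}"
proof -
  have "(p \<circ> reflect n) i > (p \<circ> reflect n) (i + 1) \<longleftrightarrow> n - i \<notin> descent_positions n p"
    if i: "i \<in> {1..n - 1}" for i
  proof -
    have "reflect n i = Suc (n - i)" "reflect n (i + 1) = n - i" "n - i \<in> {1..n - 1}"
      using i by (auto simp: reflect_def)
    moreover have "p (Suc (n - i)) \<noteq> p (n - i)" by (simp add: inj_eq[OF permutes_inj[OF p]])
    ultimately show ?thesis unfolding descent_positions_def by (simp add: not_less le_less)
  qed
  then show ?thesis unfolding descent_positions_def[of n "p \<circ> reflect n"] by blast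
qed

section \<open>Assembling the bijection\<close>

lemma bij_betw_Collect_pairs:
  assumes h: "bij_betw h A B" and g: "bij_betw g X Y"
    and "\<And>a x. a \<in> A \<Longrightarrow> x \<in> X \<Longrightarrow> Q (h a) (g x) \<longleftrightarrow> R a x"
  shows "bij_betw (map_prod h g) {(a, x). a \<in> A \<and> x \<in> X \<and> R a x} {(b, y). b \<in> B \<and> y \<in> Y \<and> Q b y}"
proof (rule bij_betw_subset[OF bij_betw_map_prod[OF h g]])
  show "map_prod h g ` {(a, x). a \<in> A \<and> x \<in> X \<and> R a x} = {(b, y). b \<in> B \<and> y \<in> Y \<and> Q b y}"
    using assms by (fastforce simp: bij_betw_def image_iff)
qed auto

theorem theorem15:
  fixes n :: nat
  assumes "n \<ge> 1"
  shows "(\<exists>f. bij_betw f (labeled_interval_orders n) (SIGMA S:Pow {1..n - 1}. beta n S \<times> kappa n S))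
    \<and> bij_betw snd (SIGMA S:Pow {1..n - 1}. beta n S \<times> kappa n S)
        {(p, t). p permutes {1..n} \<and> t permutes {1..n} \<and> ascent_bottoms n t \<subseteq> descent_positions n p}"
proof -
  let ?T = "{(p, t). p permutes {1..n} \<and> t permutes {1..n} \<and> ascent_bottoms n t \<subseteq> descent_positions n p}"
  let ?S = "SIGMA S:Pow {1..n - 1}. beta n S \<times> kappa n S"
  let ?rev = "\<lambda>p. p \<circ> reflect n"
  have snd: "bij_betw snd ?S ?T"
    by (rule bij_betw_byWitness[where f' = "\<lambda>(p, t). (descent_positions n p, p, t)"])
      (auto simp: beta_def kappa_def descent_positions_def)
  obtain g where g: "bij_betw g (subdiagonal n) {t. t permutes {1..n}}"
    and asc: "\<And>f. f \<in> subdiagonal n \<Longrightarrow>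
      ascent_bottoms n (g f) = (\<lambda>x. n - x) ` ({1..n - 1} - f ` {1..n})"
    using bij_betw_subdiagonal_permutations assms by blast
  \<comment> \<open>Both sides are complements within \<open>{1..n - 1}\<close>, carried along by
    \<open>x \<mapsto> n - x\<close>, so their inclusion is the reversed inclusion of the original
    sets.\<close>
  have "ascent_bottoms n (g f) \<subseteq> descent_positions n (?rev p) \<longleftrightarrow> descent_positions n p \<subseteq> f ` {1..n}"
    if p: "p permutes {1..n}" and f: "f \<in> subdiagonal n" for p f
  proof -
    have "descent_positions n p \<subseteq> {1..n - 1}" by (auto simp: descent_positions_def)
    then have "descent_positions n p \<subseteq> f ` {1..n} \<longleftrightarrow>
        (\<forall>x\<in>{1..n - 1} - f ` {1..n}. x \<notin> descent_positions n p)" by blast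
    also have "\<dots> \<longleftrightarrow> (\<forall>x\<in>{1..n - 1} - f ` {1..n}. n - x \<in> descent_positions n (?rev p))"
    proof (rule ball_cong)
      fix x assume "x \<in> {1..n - 1} - f ` {1..n}"
      then have "n - x \<in> {1..n - 1}" "n - (n - x) = x" by auto
      then show "x \<notin> descent_positions n p \<longleftrightarrow> n - x \<in> descent_positions n (?rev p)"
        by (simp add: descent_positions_reflect[OF p])
    qed simp
    finally show ?thesis unfolding asc[OF f] image_subset_iff by (rule sym)
  qed
  then have "bij_betw (map_prod ?rev g)
      {(p, f). p \<in> {p. p permutes {1..n}} \<and> f \<in> subdiagonal n \<and> descent_positions n p \<subseteq> f ` {1..n}}
      {(p, t). p \<in> {p. p permutes {1..n}} \<and> t \<in> {t. t permutes {1..n}}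
        \<and> ascent_bottoms n t \<subseteq> descent_positions n p}"
    by (intro bij_betw_Collect_pairs[OF bij_betw_reflect g]) auto
  then have "bij_betw (map_prod ?rev g) (order_codes n) ?T"
    by (simp add: order_codes_def)
  with bij_betw_inv_into[OF bij_betw_order_of] have "\<exists>f. bij_betw f (labeled_interval_orders n) ?T"
    by (blast intro: bij_betw_trans)
  with bij_betw_inv_into[OF snd] have "\<exists>f. bij_betw f (labeled_interval_orders n) ?S"
    by (blast intro: bij_betw_trans)
  with snd show ?thesis by blast
qed

end
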